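(* Let $I\subset(0,1)$ and $H\subset\mathbb{R}$ be compact. As $r\to\infty$ ($r$ real), uniformly for $p\in I$ and for $t\in H$ with $k:=\mu+t\in\mathbb{Z}_{\ge0}$, one has the complete asymptotic expansion $$\log\Bigl[\sqrt{2\pi\,\frac{k(k+r)}{r}}\;P(k)\Bigr]\sim\sum_{n\ge1}\frac{\widehat A_n(t;p)}{r^{n}},$$ where $$\widehat A_n(t;p)=\frac{(-1)^{n+1}}{n(n+1)}\Bigl[-B_{n+1}-\Bigl(\Bigl(\frac pq\Bigr)^{n}-p^{n}\Bigr)\widehat B_{n+1}(t)\Bigr].$$
   Context: For real $r>0$ and $p\in(0,1)$, put $q=1-p$. The negative binomial law $\mathrm{NB}(r,p)$ (failures parametrisation) has mass function $$P(k)=\frac{\Gamma(k+r)}{\Gamma(r)\,\Gamma(k+1)}\,p^{r}q^{k},\qquad k\in\mathbb{Z}_{\ge0},$$ and $\mu=rq/p$ is its mean. $B_n(t)$ denotes the Bernoulli polynomials, $\sum_{n\ge0}B_n(t)z^n/n!=ze^{tz}/(e^z-1)$, and $B_n=B_n(0)$ the Bernoulli numbers. The reciprocal Bernoulli polynomials are $$\widehat B_n(t)=\tfrac12\bigl[B_n(t)+B_n(t+1)\bigr]=B_n(t)+\tfrac n2\,t^{n-1}\qquad(n\ge1).$$ Meaning of the expansion: for every fixed integer $M\ge0$, the difference between the left-hand side and $\sum_{n=1}^{M}\widehat A_n(t;p)r^{-n}$ is $O(r^{-M-1})$ as $r\to\infty$, with implied constant and threshold on $r$ depending only on $M$, $I$,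 $H$ (for $r$ large, $k>0$, so the logarithm is defined). *)

theory Defs
  imports "HOL-Analysis.Analysis" "HOL-Computational_Algebra.Formal_Power_Series"
begin

text \<open>
  The generating function is read as a quotient of formal power series in \<open>z\<close>. Division of
  formal power series cancels the common factor \<open>z\<close> of numerator and denominator, so this is
  the exact quotient; see \<open>bernpoly_gen_fun\<close>.
\<close>

definition bernpoly :: "nat \<Rightarrow> real \<Rightarrow> real" where
  "bernpoly n t = fact n * fps_nth (fps_X * fps_exp t / (fps_exp 1 - 1)) n"

definition bernoulli :: "nat \<Rightarrow> real" where
  "bernoulli n = bernpoly n 0"

definition recip_bernpoly :: "nat \<Rightarrow> real \<Rightarrow> real" where
  "recip_bernpoly n t = (bernpoly n t + bernpoly n (t + 1)) / 2"

text \<open>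
  Negative binomial law with real parameter \<open>r\<close> (the library's \<open>neg_binomial_pmf\<close> covers natural
  \<open>r\<close> only), counting failures; \<open>p\<close> is the success probability.
\<close>

definition nb_mass :: "real \<Rightarrow> real \<Rightarrow> nat \<Rightarrow> real" where
  "nb_mass r p k =
     Gamma (real k + r) / (Gamma r * Gamma (real k + 1)) * p powr r * (1 - p) ^ k"

definition nb_mean :: "real \<Rightarrow> real \<Rightarrow> real" where
  "nb_mean r p = r * (1 - p) / p"

definition A_hat :: "nat \<Rightarrow> real \<Rightarrow> real \<Rightarrow> real" where
  "A_hat n t p = (-1) ^ (n + 1) / (real n * (real n + 1)) *
     (- bernoulli (n + 1) - ((p / (1 - p)) ^ n - p ^ n) * recip_bernpoly (n + 1) t)"

lemma bernpoly_gen_fun: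
  "Abs_fps (\<lambda>n. bernpoly n t / fact n) * (fps_exp 1 - 1) = fps_X * fps_exp t"
proof -
  let ?g = "fps_exp 1 - 1 :: real fps"
  have g1: "fps_nth ?g 1 \<noteq> 0" by simp
  have nz: "?g \<noteq> 0" using g1 by (metis fps_zero_nth)
  have "subdegree ?g \<le> 1" using g1 by (rule subdegree_leI)
  moreover have "subdegree (fps_X * fps_exp t :: real fps) \<ge> 1"
    by (rule subdegree_geI) (auto simp: fps_eq_iff intro!: exI[of _ 1])
  ultimately have "?g dvd fps_X * fps_exp t"
    using nz by (subst fps_dvd_iff) (auto simp: fps_eq_iff)
  moreover have "Abs_fps (\<lambda>n. bernpoly n t / fact n) = fps_X * fps_exp t / ?g"
    by (simp add: bernpoly_def fps_eq_iff)
  ultimately show ?thesis by simp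
qed

lemma recip_bernpoly_altdef:
  assumes "n \<ge> 1"
  shows "recip_bernpoly n t = bernpoly n t + real n / 2 * t ^ (n - 1)"
proof -
  let ?B = "\<lambda>t. Abs_fps (\<lambda>n. bernpoly n t / fact n)"
  let ?g = "fps_exp 1 - 1 :: real fps"
  have "fps_nth ?g 1 \<noteq> 0" by simp
  hence nz: "?g \<noteq> 0" by (metis fps_zero_nth)
  have "(?B (t + 1) - ?B t) * ?g = fps_X * fps_exp (t + 1) - fps_X * fps_exp t"
    by (simp only: left_diff_distrib bernpoly_gen_fun)
  also have "\<dots> = (fps_X * fps_exp t) * ?g"
    by (simp add: fps_exp_add_mult algebra_simps)
  finally have "?B (t + 1) - ?B t = fps_X * fps_exp t"
    using nz by simp
  hence "fps_nth (?B (t + 1) - ?B t) n = fps_nth (fps_X * fps_exp t) n" by simp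
  hence "bernpoly n (t + 1) - bernpoly n t = fact n * (t ^ (n - 1) / fact (n - 1))"
    using assms by (simp add: field_simps)
  also have "\<dots> = real n * t ^ (n - 1)"
    using assms by (simp add: fact_reduce)
  finally show ?thesis by (simp add: recip_bernpoly_def field_simps)
qed

end

theory Submission
  imports Defs "HOL-Real_Asymp.Real_Asymp"
begin

text \<open>
  Put \<open>G y = ln_Gamma y + ln y / 2\<close>. The square root in the statement symmetrises the mass function:
  up to elementary terms the logarithm is \<open>G (k + r) - G r - G k\<close> (lemma \<open>ln_nb_mass\<close>). Here
  \<open>k + r = r / p + t\<close> and \<open>k = r * (1 - p) / p + t\<close>, so a Stirling expansion of \<open>G (x + t)\<close> in powers
  of \<open>1 / x\<close>, uniform for bounded \<open>t\<close>, applies to all three terms. Its coefficients are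
  \<open>(-1) ^ (n + 1) * Bhat (n + 1) t / (n (n + 1))\<close>, with \<open>Bhat n\<close> for
  \<^term>\<open>recip_bernpoly n\<close>, and substituting the three base points gives \<^const>\<open>A_hat\<close> (lemma \<open>stirling_sum_A_hat\<close>).

  The expansion (theorem \<open>stirling_expansion\<close>) follows from two properties of the reciprocal
  Bernoulli polynomials. Since \<open>(Bhat (n + 1))' = (n + 1) * Bhat n\<close>, the truncated
  series at base point \<open>x\<close> and offset \<open>t\<close> is a function of \<open>x + t\<close> alone, up to \<open>O(1 / x ^ (M + 1))\<close> (lemma
  \<open>stirling_error_transport\<close>). Since
  \<open>Bhat (n + 1) (t + 1) - Bhat (n + 1) t = (n + 1) * (t ^ n + (t + 1) ^ n) / 2\<close>, the
  series satisfies the functional equation of \<open>G\<close> up to the same order, because the right-hand side produces a Taylor polynomial of the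
  logarithm (lemma \<open>stirling_error_shift\<close>). Hence the error of the series changes by
  \<open>O(1 / x ^ (M + 1))\<close> when \<open>x\<close> increases by \<open>1\<close>. It tends to \<open>0\<close> along \<open>x + n\<close>, by Euler's limit
  for \<open>ln_Gamma\<close> and the duplication formula (lemma \<open>stirling_error_0_tendsto_0\<close>), so summing the
  steps backwards from infinity bounds the error itself.
\<close>

section \<open>Reciprocal Bernoulli polynomials\<close>

lemma bernpoly_plus1:
  assumes "n \<ge> 1"
  shows "bernpoly n (t + 1) = bernpoly n t + real n * t ^ (n - 1)"
  using recip_bernpoly_altdef[OF assms, of t] by (simp add: recip_bernpoly_def)

lemma recip_bernpoly_plus1:
  assumes "n \<ge> 1"
  shows "recip_bernpoly n (t + 1)
    = recip_bernpoly n t + real n * (t ^ (n - 1) + (t + 1) ^ (n - 1)) / 2"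
  using bernpoly_plus1[OF assms, of t] bernpoly_plus1[OF assms, of "t + 1"]
  by (simp add: recip_bernpoly_def field_simps)

lemma recip_bernpoly_0:
  assumes "n \<ge> 2"
  shows "recip_bernpoly n 0 = bernoulli n"
  using assms by (simp add: recip_bernpoly_altdef bernoulli_def power_0_left)

text \<open>
  The generating function at \<open>t\<close> is \<open>exp (t z)\<close> times the one at \<open>0\<close>, so the claim is a Cauchy product.
  It is what makes \<^term>\<open>bernpoly n\<close> a differentiable function of \<open>t\<close>.
\<close>
lemma bernpoly_conv_bernoulli:
  "bernpoly n t = (\<Sum>j\<le>n. real (n choose j) * bernoulli (n - j) * t ^ j)"
proof -
  let ?B = "\<lambda>t. Abs_fps (\<lambda>n. bernpoly n t / fact n)"
  let ?g = "fps_exp 1 - 1 :: real fps"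
  have "fps_nth ?g 1 \<noteq> 0" by simp
  hence nz: "?g \<noteq> 0" by (metis fps_zero_nth)
  have "?B t * ?g = (fps_exp t * ?B 0) * ?g"
    using bernpoly_gen_fun[of t] bernpoly_gen_fun[of 0] by (simp add: mult_ac)
  hence "?B t = fps_exp t * ?B 0"
    using nz by simp
  hence "fps_nth (?B t) n = fps_nth (fps_exp t * ?B 0) n" by simp
  also have "\<dots> = (\<Sum>j\<le>n. t ^ j / fact j * (bernoulli (n - j) / fact (n - j)))"
    by (simp add: fps_mult_nth bernoulli_def atMost_atLeast0)
  finally have "bernpoly n t
      = fact n * (\<Sum>j\<le>n. t ^ j / fact j * (bernoulli (n - j) / fact (n - j)))"
    by (simp add: field_simps)
  also have "\<dots> = (\<Sum>j\<le>n. real (n choose j) * bernoulli (n - j) * t ^ j)"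
    unfolding sum_distrib_left by (intro sum.cong) (auto simp: binomial_fact)
  finally show ?thesis .
qed

lemma has_real_derivative_bernpoly:
  "(bernpoly (Suc n) has_real_derivative real (Suc n) * bernpoly n t) (at t)"
proof -
  have "bernpoly (Suc n)
      = (\<lambda>t. \<Sum>j\<le>Suc n. real (Suc n choose j) * bernoulli (Suc n - j) * t ^ j)"
    by (rule ext) (rule bernpoly_conv_bernoulli)
  moreover have "((\<lambda>t. \<Sum>j\<le>Suc n. real (Suc n choose j) * bernoulli (Suc n - j) * t ^ j)
      has_real_derivative
        (\<Sum>j\<le>Suc n. real (Suc n choose j) * bernoulli (Suc n - j) * (real j * t ^ (j - 1)))) (at t)"
    by (intro DERIV_sum DERIV_cmult) (auto intro!: derivative_eq_intros)
  moreover have "(\<Sum>j\<le>Suc n. real (Suc n choose j) * bernoulli (Suc n - j) * (real j * t ^ (j - 1)))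
      = (\<Sum>j\<le>n. real (Suc j * (Suc n choose Suc j)) * bernoulli (n - j) * t ^ j)"
    by (subst sum.atMost_Suc_shift) (simp add: algebra_simps del: binomial_Suc_Suc)
  moreover have "\<dots> = real (Suc n) * bernpoly n t"
    unfolding Suc_times_binomial bernpoly_conv_bernoulli[of n t] sum_distrib_left
    by (simp add: algebra_simps)
  ultimately show ?thesis by metis
qed

lemma has_real_derivative_recip_bernpoly:
  "(recip_bernpoly (Suc n) has_real_derivative real (Suc n) * recip_bernpoly n t) (at t)"
proof -
  have "recip_bernpoly (Suc n) = (\<lambda>t. (bernpoly (Suc n) t + bernpoly (Suc n) (t + 1)) / 2)"
    by (rule ext) (rule recip_bernpoly_def)
  moreover have "((\<lambda>t. (bernpoly (Suc n) t + bernpoly (Suc n) (t + 1)) / 2)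
      has_real_derivative
        (real (Suc n) * bernpoly n t + real (Suc n) * bernpoly n (t + 1) * 1) / 2) (at t)"
    by (intro DERIV_cdivide DERIV_add has_real_derivative_bernpoly
          DERIV_chain'[where g = "bernpoly (Suc n)"])
       (auto intro!: derivative_eq_intros)
  ultimately show ?thesis
    by (simp add: recip_bernpoly_def ring_distribs)
qed

text \<open>
  This is where averaging over \<open>t\<close> and \<open>t + 1\<close> matters: \<open>t - 1/2\<close> becomes \<open>t\<close>, which matches the
  leading term \<open>(x + t) ln x\<close> of the Stirling sum below.
\<close>
lemma recip_bernpoly_1: "recip_bernpoly 1 t = t"
proof -
  have nth: "fps_nth (Abs_fps (\<lambda>n. bernpoly n t / fact n) * (fps_exp 1 - 1)) n
      = fps_nth (fps_X * fps_exp t) n" for n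
    by (simp only: bernpoly_gen_fun)
  have 1: "bernpoly 0 t = 1"
    using nth[of 1] by (simp add: fps_mult_nth)
  have "bernpoly 0 t / 2 + bernpoly 1 t = t"
    using nth[of 2] by (simp add: fps_mult_nth numeral_2_eq_2)
  with 1 show ?thesis
    by (simp add: recip_bernpoly_altdef)
qed

lemma recip_bernpoly_bounded:
  obtains K where "K \<ge> 0" "\<And>t. \<bar>t\<bar> \<le> T \<Longrightarrow> \<bar>recip_bernpoly (Suc n) t\<bar> \<le> K"
proof -
  have "continuous_on {-T..T} (recip_bernpoly (Suc n))"
    by (rule DERIV_continuous_on[where D = "\<lambda>t. real (Suc n) * recip_bernpoly n t"])
       (rule has_field_derivative_at_within[OF has_real_derivative_recip_bernpoly])
  hence "bounded (recip_bernpoly (Suc n) ` {-T..T})"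
    by (intro compact_imp_bounded compact_continuous_image) auto
  then obtain K where "\<And>y. y \<in> recip_bernpoly (Suc n) ` {-T..T} \<Longrightarrow> \<bar>y\<bar> \<le> K"
    unfolding bounded_iff by auto
  hence "\<bar>recip_bernpoly (Suc n) t\<bar> \<le> \<bar>K\<bar>" if "\<bar>t\<bar> \<le> T" for t
    using that abs_ge_self[of K] by (meson abs_le_iff atLeastAtMost_iff imageI minus_le_iff order_trans)
  thus ?thesis by (intro that[of "\<bar>K\<bar>"]) auto
qed

section \<open>The shifted Stirling sum and its error\<close>

text \<open>
  The truncated asymptotic series in \<open>1/x\<close>, at a fixed offset \<open>t\<close>, of
  \<open>ln_Gamma (x + t) + ln (x + t) / 2\<close>, that is, of the mean of \<open>ln_Gamma (x + t)\<close> and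
  \<open>ln_Gamma (x + t + 1)\<close>. This mean turns Bernoulli polynomials into reciprocal ones.
\<close>
definition stirling_sum :: "nat \<Rightarrow> real \<Rightarrow> real \<Rightarrow> real" where
  "stirling_sum M x t = (x + t) * ln x - x + ln (2 * pi) / 2 +
     (\<Sum>n=1..M. (-1) ^ (n + 1) * recip_bernpoly (n + 1) t / (real n * (real n + 1) * x ^ n))"

definition stirling_error :: "nat \<Rightarrow> real \<Rightarrow> real \<Rightarrow> real" where
  "stirling_error M x t = ln_Gamma (x + t) + ln (x + t) / 2 - stirling_sum M x t"

lemma stirling_sum_Suc:
  "stirling_sum (Suc M) x t = stirling_sum M x t +
     (-1) ^ M * recip_bernpoly (M + 2) t / (real (M + 1) * real (M + 2) * x ^ (M + 1))"
  by (simp add: stirling_sum_def field_simps)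

text \<open>
  The approximated function depends only on \<open>x + t\<close>, so the sum should hardly change along the
  lines where \<open>x + t\<close> is constant. Indeed the derivative of \<open>Bhat (n + 1)\<close> in the numerator of the
  \<open>n\<close>-th term cancels the derivative of the power of \<open>x\<close> in the denominator of the previous one,
  and only the last term contributes, with order \<open>1 / x ^ (M + 1)\<close>.
\<close>
lemma has_real_derivative_stirling_sum_diagonal:
  assumes "x + s > 0"
  shows "((\<lambda>s. stirling_sum M (x + s) (t - s)) has_real_derivative
           (-1) ^ M * recip_bernpoly (M + 1) (t - s) / (real (M + 1) * (x + s) ^ (M + 1))) (at s)"
proof (induction M)
  case 0
  have "((\<lambda>s. (x + t) * ln (x + s) - (x + s) + ln (2 * pi) / 2) has_real_derivative
          (t - s) / (x + s)) (at s)"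
  proof (rule DERIV_cong)
    show "((\<lambda>s. (x + t) * ln (x + s) - (x + s) + ln (2 * pi) / 2) has_real_derivative
            (x + t) * (1 / (x + s)) - 1) (at s)"
      using assms by (auto intro!: derivative_eq_intros)
    show "(x + t) * (1 / (x + s)) - 1 = (t - s) / (x + s)"
      using assms by (simp add: field_simps)
  qed
  thus ?case
    using recip_bernpoly_1[of "t - s"] by (simp add: stirling_sum_def)
next
  case (Suc M)
  let ?b = "\<lambda>n. recip_bernpoly n (t - s)"
  have bern: "((\<lambda>s. recip_bernpoly (Suc (Suc M)) (t - s)) has_real_derivative
          real (Suc (Suc M)) * ?b (Suc M) * (-1)) (at s)"
    by (rule DERIV_chain'[where g = "recip_bernpoly (Suc (Suc M))",
             OF _ has_real_derivative_recip_bernpoly])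
       (auto intro!: derivative_eq_intros)
  define c :: real where "c = (-1) ^ M / (real (M + 1) * real (M + 2))"
  have c: "c * real (M + 1) = (-1) ^ M / real (M + 2)" "c * real (M + 2) = (-1) ^ M / real (M + 1)"
    by (simp_all add: c_def divide_simps)
  have inv: "((\<lambda>s. inverse (x + s) ^ (M + 1)) has_real_derivative
          - (real (M + 1) * inverse (x + s) ^ (M + 2))) (at s)"
  proof -
    have "((\<lambda>s. inverse (x + s)) has_real_derivative - (inverse (x + s) * 1 * inverse (x + s))) (at s)"
      using assms by (intro DERIV_inverse') (auto intro!: derivative_eq_intros)
    from DERIV_power_Suc[OF this, of M] show ?thesis
      by (simp add: mult_ac)
  qed
  have "((\<lambda>s. c * (recip_bernpoly (Suc (Suc M)) (t - s) * inverse (x + s) ^ (M + 1)))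
          has_real_derivative
            c * (real (Suc (Suc M)) * ?b (Suc M) * (-1) * inverse (x + s) ^ (M + 1)
               + - (real (M + 1) * inverse (x + s) ^ (M + 2)) * ?b (Suc (Suc M)))) (at s)"
    by (rule DERIV_cmult[OF DERIV_mult[OF bern inv]])
  also have "c * (real (Suc (Suc M)) * ?b (Suc M) * (-1) * inverse (x + s) ^ (M + 1)
               + - (real (M + 1) * inverse (x + s) ^ (M + 2)) * ?b (Suc (Suc M)))
      = - (c * real (M + 2)) * ?b (M + 1) * inverse (x + s) ^ (M + 1)
        - (c * real (M + 1)) * ?b (M + 2) * inverse (x + s) ^ (M + 2)"
    by (simp add: algebra_simps)
  also have "\<dots> = - ((-1) ^ M * ?b (M + 1) / (real (M + 1) * (x + s) ^ (M + 1)))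
          + (-1) ^ Suc M * ?b (Suc M + 1) / (real (Suc M + 1) * (x + s) ^ (Suc M + 1))"
    unfolding c by (simp add: power_inverse divide_simps)
  finally have "((\<lambda>s. (-1) ^ M * recip_bernpoly (M + 2) (t - s)
               / (real (M + 1) * real (M + 2) * (x + s) ^ (M + 1))) has_real_derivative
          - ((-1) ^ M * ?b (M + 1) / (real (M + 1) * (x + s) ^ (M + 1)))
          + (-1) ^ Suc M * ?b (Suc M + 1) / (real (Suc M + 1) * (x + s) ^ (Suc M + 1))) (at s)"
    by (simp only: c_def power_inverse divide_inverse inverse_mult_distrib ac_simps One_nat_def
          add_Suc_right add_0_right add_0_left numeral_2_eq_2)
  from DERIV_add[OF Suc.IH this] show ?case
    unfolding stirling_sum_Suc by (simp only: add.assoc[symmetric] add.right_inverse add_0)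
qed

text \<open>
  The derivative of the remainder is \<open>1 / (1 + v)\<close> minus a geometric sum, which leaves
  \<open>(- v) ^ M / (1 + v)\<close> for every \<open>v \<ge> 0\<close>.
\<close>
lemma ln_1_plus_taylor_bound:
  assumes "u \<ge> (0::real)"
  shows "\<bar>ln (1 + u) - (\<Sum>n=1..M. (-1) ^ (n + 1) * u ^ n / real n)\<bar> \<le> u ^ (M + 1)"
proof -
  define h :: "real \<Rightarrow> real" where "h = (\<lambda>v. ln (1 + v) - (\<Sum>n=1..M. (-1) ^ (n + 1) * v ^ n / real n))"
  have deriv: "(h has_real_derivative (- v) ^ M / (1 + v)) (at v)" if "v \<ge> 0" for v
  proof -
    have "(h has_real_derivative 1 / (1 + v) - (\<Sum>n=1..M. (-1) ^ (n + 1) * v ^ (n - 1))) (at v)"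
      unfolding h_def using that by (auto intro!: derivative_eq_intros sum.cong)
    also have "(\<Sum>n=1..M. (-1) ^ (n + 1) * v ^ (n - 1)) = (\<Sum>n<M. (- v) ^ n)"
      by (rule sum.reindex_bij_witness[of _ Suc "\<lambda>n. n - 1"])
         (auto simp: power_minus[of v] minus_one_power_iff)
    also have "\<dots> = (1 - (- v) ^ M) / (1 + v)"
      using that by (subst sum_gp_strict) auto
    finally show ?thesis
      by (simp add: diff_divide_distrib)
  qed
  have "norm (h u - h 0) \<le> u ^ M * norm (u - 0)"
  proof (rule field_differentiable_bound[where f = h and f' = "\<lambda>v. (- v) ^ M / (1 + v)" and S = "{0..u}"])
    fix v assume v: "v \<in> {0..u}"
    show "(h has_real_derivative (- v) ^ M / (1 + v)) (at v within {0..u})"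
      using v by (auto intro: has_field_derivative_at_within[OF deriv])
    have "v ^ M / (1 + v) \<le> v ^ M / 1"
      using v by (intro divide_left_mono) auto
    also have "\<dots> \<le> u ^ M" using v by (auto intro: power_mono)
    finally show "norm ((- v) ^ M / (1 + v)) \<le> u ^ M"
      using v by (simp add: power_abs)
  qed (use assms in auto)
  moreover have "h 0 = 0" by (auto simp: h_def intro!: sum.neutral)
  ultimately show ?thesis
    using assms by (simp add: h_def mult_ac)
qed

text \<open>
  Integrating the diagonal derivative moves the offset into the base point, uniformly in the offset.
  For \<open>x \<ge> 2 T\<close> all base points on the way are at least \<open>x / 2\<close>, which costs the factor
  \<open>2 ^ (M + 1)\<close>; the offsets on the way are bounded by \<open>2 T\<close>.
\<close>
lemma stirling_error_transport:
  assumes "T \<ge> 0"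
  obtains C where
    "\<And>x t. x > 0 \<Longrightarrow> x \<ge> 2 * T \<Longrightarrow> \<bar>t\<bar> \<le> T \<Longrightarrow>
       \<bar>stirling_error M x t - stirling_error M (x + t) 0\<bar> \<le> C / x ^ (M + 1)"
proof -
  obtain K where K: "K \<ge> 0" "\<And>t. \<bar>t\<bar> \<le> 2 * T \<Longrightarrow> \<bar>recip_bernpoly (M + 1) t\<bar> \<le> K"
    using recip_bernpoly_bounded[of "2 * T" M] by auto
  have "\<bar>stirling_error M x t - stirling_error M (x + t) 0\<bar> \<le> (K * 2 ^ (M + 1) * T) / x ^ (M + 1)"
    if x: "x > 0" "x \<ge> 2 * T" and t: "\<bar>t\<bar> \<le> T" for x t
  proof -
    define f where "f = (\<lambda>s. stirling_sum M (x + s) (t - s))"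
    define f' where "f' = (\<lambda>s. (-1) ^ M * recip_bernpoly (M + 1) (t - s)
                                 / (real (M + 1) * (x + s) ^ (M + 1)))"
    have "norm (f t - f 0) \<le> K / (x / 2) ^ (M + 1) * norm (t - 0)"
    proof (rule field_differentiable_bound[where f = f and f' = f' and S = "{-T..T}"])
      fix s assume s: "s \<in> {-T..T}"
      have s': "x / 2 \<le> x + s" "x + s > 0" "\<bar>t - s\<bar> \<le> 2 * T"
        using s x t by auto
      show "(f has_real_derivative f' s) (at s within {-T..T})"
        unfolding f_def f'_def using s'
        by (intro has_field_derivative_at_within[OF has_real_derivative_stirling_sum_diagonal]) auto
      have "norm (f' s) = \<bar>recip_bernpoly (M + 1) (t - s)\<bar> / (real (M + 1) * (x + s) ^ (M + 1))"
        using s' by (simp add: f'_def abs_mult power_abs)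
      also have "\<dots> \<le> K / (x / 2) ^ (M + 1)"
      proof (rule frac_le)
        have "(x / 2) ^ (M + 1) \<le> 1 * (x + s) ^ (M + 1)"
          using s' x by (simp only: mult_1) (intro power_mono, auto)
        also have "\<dots> \<le> real (M + 1) * (x + s) ^ (M + 1)"
          using s' by (intro mult_right_mono) auto
        finally show "(x / 2) ^ (M + 1) \<le> real (M + 1) * (x + s) ^ (M + 1)" .
      qed (use K s' x in auto)
      finally show "norm (f' s) \<le> K / (x / 2) ^ (M + 1)" .
    qed (use assms t in auto)
    also have "K / (x / 2) ^ (M + 1) * norm (t - 0) \<le> K / (x / 2) ^ (M + 1) * T"
      using x K t by (intro mult_left_mono) auto
    also have "\<dots> = (K * 2 ^ (M + 1) * T) / x ^ (M + 1)"
      by (simp add: power_divide)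
    finally show ?thesis
      by (simp add: f_def stirling_error_def)
  qed
  thus ?thesis by (rule that)
qed

lemma ln_Gamma_real_plus1: "(x::real) > 0 \<Longrightarrow> ln_Gamma (x + 1) = ln x + ln_Gamma x"
  using Gamma_plus1[of x] Gamma_real_pos[of x]
  by (fastforce simp: ln_Gamma_real_pos ln_mult_pos elim: nonpos_Ints_cases)

text \<open>
  By the difference equation of the reciprocal Bernoulli polynomials, passing from offset \<open>0\<close> to
  offset \<open>1\<close> changes the Stirling sum by \<open>ln x\<close> plus half of a Taylor polynomial of
  \<open>ln (1 + 1/x)\<close>, whereas the functional equation of \<open>ln_Gamma\<close> gives
  \<open>ln x + ln (1 + 1/x) / 2\<close>.
\<close>
lemma stirling_error_shift:
  assumes "x \<ge> 1"
  shows "\<bar>stirling_error M x 1 - stirling_error M x 0\<bar> \<le> 1 / x ^ (M + 1)"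
proof -
  let ?S = "\<lambda>t. \<Sum>n=1..M. (-1) ^ (n + 1) * recip_bernpoly (n + 1) t / (real n * (real n + 1) * x ^ n)"
  have "?S 1 - ?S 0 = (\<Sum>n=1..M. (-1) ^ (n + 1) * (1 / x) ^ n / real n / 2)"
    unfolding sum_subtractf [symmetric]
  proof (intro sum.cong refl)
    fix n assume n: "n \<in> {1..M}"
    have "recip_bernpoly (n + 1) 1 = recip_bernpoly (n + 1) 0 + (real n + 1) / 2"
      using recip_bernpoly_plus1[of "n + 1" 0] n by (simp add: power_0_left)
    thus "(-1) ^ (n + 1) * recip_bernpoly (n + 1) 1 / (real n * (real n + 1) * x ^ n)
        - (-1) ^ (n + 1) * recip_bernpoly (n + 1) 0 / (real n * (real n + 1) * x ^ n)
        = (-1) ^ (n + 1) * (1 / x) ^ n / real n / 2"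
      using n assms unfolding \<open>recip_bernpoly (n + 1) 1 = _\<close>
      by (simp add: power_divide divide_simps) (simp add: algebra_simps)
  qed
  also have "\<dots> = (\<Sum>n=1..M. (-1) ^ (n + 1) * (1 / x) ^ n / real n) / 2"
    by (rule sum_divide_distrib [symmetric])
  finally have S: "?S 1 - ?S 0 = (\<Sum>n=1..M. (-1) ^ (n + 1) * (1 / x) ^ n / real n) / 2" .
  have ln: "ln (1 + 1 / x) = ln (x + 1) - ln x"
  proof -
    have "1 + 1 / x = (x + 1) / x" using assms by (simp add: field_simps)
    thus ?thesis using assms by (simp add: ln_div)
  qed
  have "stirling_error M x 1 - stirling_error M x 0
      = (ln (1 + 1 / x) - (\<Sum>n=1..M. (-1) ^ (n + 1) * (1 / x) ^ n / real n)) / 2"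
    using S ln ln_Gamma_real_plus1[of x] assms
    by (simp add: stirling_error_def stirling_sum_def field_simps)
  moreover have "\<bar>ln (1 + 1 / x) - (\<Sum>n=1..M. (-1) ^ (n + 1) * (1 / x) ^ n / real n)\<bar> \<le> 1 / x ^ (M + 1)"
    using ln_1_plus_taylor_bound[of "1 / x" M] assms by (simp add: power_divide)
  moreover have "\<bar>y / 2\<bar> \<le> z" if "\<bar>y\<bar> \<le> z" for y z :: real
    using that by linarith
  ultimately show ?thesis by simp
qed

text \<open>
  Passing to offset \<open>1\<close> and then moving this offset into the base point makes a unit step in \<open>x\<close>.
\<close>
lemma stirling_error_step:
  obtains C where "C \<ge> 0"
    "\<And>x. x \<ge> 2 \<Longrightarrow> \<bar>stirling_error M (x + 1) 0 - stirling_error M x 0\<bar> \<le> C / x ^ (M + 1)"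
proof -
  obtain C where C: "\<And>x t. x > 0 \<Longrightarrow> x \<ge> 2 * 1 \<Longrightarrow> \<bar>t\<bar> \<le> 1 \<Longrightarrow>
       \<bar>stirling_error M x t - stirling_error M (x + t) 0\<bar> \<le> C / x ^ (M + 1)"
    by (rule stirling_error_transport[of 1 M]) auto
  have *: "\<bar>stirling_error M (x + 1) 0 - stirling_error M x 0\<bar> \<le> (C + 1) / x ^ (M + 1)"
    if "x \<ge> 2" for x
    using C[of x 1] stirling_error_shift[of x M] that by (simp add: add_divide_distrib)
  have "0 \<le> (C + 1) / 2 ^ (M + 1)"
    using order.trans[OF abs_ge_zero *[of 2]] by simp
  hence "C + 1 \<ge> 0"
    by (rule contrapos_pp) (simp add: not_le divide_neg_pos)
  from this * show ?thesis by (rule that)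
qed

section \<open>The constant in Stirling's formula\<close>

lemma stirling_error_0_eq:
  "stirling_error 0 x 0 = ln_Gamma x + ln x / 2 - x * ln x + x - ln (2 * pi) / 2"
  by (simp add: stirling_error_def stirling_sum_def)

lemma stirling_error_tendsto_base:
  assumes "filterlim g at_top F"
  shows "((\<lambda>n. stirling_error M (g n) 0 - stirling_error 0 (g n) 0) \<longlongrightarrow> 0) F"
proof -
  have "((\<lambda>n. - (\<Sum>i=1..M. (-1) ^ (i + 1) * recip_bernpoly (i + 1) 0 / (real i * (real i + 1))
           * inverse (g n) ^ i)) \<longlongrightarrow>
         - (\<Sum>i=1..M. (-1) ^ (i + 1) * recip_bernpoly (i + 1) 0 / (real i * (real i + 1)) * 0 ^ i)) F"
    by (intro tendsto_intros tendsto_inverse_0_at_top assms)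
  also have "(\<Sum>i=1..M. (-1) ^ (i + 1) * recip_bernpoly (i + 1) 0 / (real i * (real i + 1)) * 0 ^ i) = (0::real)"
    by (intro sum.neutral) auto
  finally show ?thesis
    by (simp add: stirling_error_def stirling_sum_def field_simps)
qed

text \<open>
  Up to the functional equation, the expression is the difference between \<open>ln_Gamma x\<close> and the
  \<open>n\<close>-th term of Euler's limit for it.
\<close>
lemma ln_Gamma_diff_asymp:
  fixes x :: real
  assumes "x > 0"
  shows "(\<lambda>n. ln_Gamma (x + real (Suc n)) - ln_Gamma (real (Suc n)) - x * ln (real n)) \<longlonglongrightarrow> 0"
proof -
  have eq: "ln_Gamma (x + real (Suc n)) - ln_Gamma (real (Suc n))
      = ln_Gamma x + ln x + (\<Sum>k=1..n. ln (x / real k + 1))" for n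
  proof (induction n)
    case 0
    show ?case using ln_Gamma_real_plus1[OF assms] by (simp add: ln_Gamma_real_pos)
  next
    case (Suc n)
    have "ln (x / real (Suc n) + 1) = ln ((x + real (Suc n)) / real (Suc n))"
      by (simp add: field_simps)
    also have "\<dots> = ln (x + real (Suc n)) - ln (real (Suc n))"
      using assms by (simp add: ln_div)
    finally show ?case
      using Suc.IH ln_Gamma_real_plus1[of "x + real (Suc n)"] ln_Gamma_real_plus1[of "real (Suc n)"] assms
      by (simp add: add_ac)
  qed
  have "(\<lambda>n. ln_Gamma x - ln_Gamma_series x n) \<longlonglongrightarrow> ln_Gamma x - ln_Gamma x"
    by (intro tendsto_intros ln_Gamma_real_LIMSEQ assms)
  thus ?thesis
    unfolding eq ln_Gamma_series_def by (simp add: algebra_simps)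
qed

lemma stirling_error_0_shift_asymp:
  assumes "x > 0"
  shows "(\<lambda>n. stirling_error 0 (x + real (Suc n)) 0 - stirling_error 0 (real (Suc n)) 0) \<longlonglongrightarrow> 0"
proof -
  have "(\<lambda>n. x * ln (real n) + ln (x + real n + 1) / 2 - ln (real n + 1) / 2
          - (x + real n + 1) * ln (x + real n + 1) + (x + real n + 1)
          + (real n + 1) * ln (real n + 1) - (real n + 1)) \<longlonglongrightarrow> 0"
    by real_asymp
  from tendsto_add[OF this ln_Gamma_diff_asymp[OF assms]] show ?thesis
    using assms by (simp add: stirling_error_0_eq algebra_simps)
qed

text \<open>
  With \<open>M = 1\<close> the unit steps of the error are \<open>O(1 / x\<^sup>2)\<close>, hence summable, and the error for
  \<open>M = 0\<close> differs from it by a null sequence.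
\<close>
lemma stirling_error_convergent: "convergent (\<lambda>n. stirling_error 0 (real n) 0)"
proof -
  define f where "f = (\<lambda>n. stirling_error 1 (real n) 0)"
  obtain C where C: "C \<ge> 0"
    "\<And>x. x \<ge> 2 \<Longrightarrow> \<bar>stirling_error 1 (x + 1) 0 - stirling_error 1 x 0\<bar> \<le> C / x ^ (1 + 1)"
    using stirling_error_step[of 1] by blast
  have "summable (\<lambda>n. f (Suc n) - f n)"
  proof (rule summable_comparison_test')
    show "summable (\<lambda>n. C * inverse (real n ^ 2))"
      by (intro summable_mult inverse_power_summable) auto
    show "norm (f (Suc n) - f n) \<le> C * inverse (real n ^ 2)" if "n \<ge> 2" for n
      using C(2)[of "real n"] that by (simp add: f_def add_ac power2_eq_square divide_inverse)
  qed
  hence "convergent (\<lambda>n. f n - f 0)"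
    by (simp add: summable_iff_convergent sum_lessThan_telescope)
  hence f: "convergent f"
    by (simp add: convergent_diff_const_right_iff)
  have "(\<lambda>n. f n - stirling_error 0 (real n) 0) \<longlonglongrightarrow> 0"
    unfolding f_def by (intro stirling_error_tendsto_base filterlim_real_sequentially)
  hence "convergent (\<lambda>n. f n - (f n - stirling_error 0 (real n) 0))"
    by (rule convergent_diff[OF f convergentI])
  thus ?thesis by simp
qed

lemma ln_Gamma_duplication:
  assumes "(z::real) > 0"
  shows "ln_Gamma z + ln_Gamma (z + 1 / 2) = (1 - 2 * z) * ln 2 + ln pi / 2 + ln_Gamma (2 * z)"
proof -
  have "complex_of_real (Gamma z * Gamma (z + 1 / 2))
      = Gamma (complex_of_real z) * Gamma (complex_of_real z + 1 / 2)"
    by (simp flip: Gamma_complex_of_real)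
  also have "\<dots> = exp ((1 - 2 * complex_of_real z) * of_real (ln 2)) * of_real (sqrt pi)
                   * Gamma (2 * complex_of_real z)"
  proof (rule Gamma_legendre_duplication)
    show "complex_of_real z \<notin> \<int>\<^sub>\<le>\<^sub>0"
      using assms by (subst of_real_in_nonpos_Ints_iff) (auto elim: nonpos_Ints_cases)
    have "complex_of_real (z + 1 / 2) \<notin> \<int>\<^sub>\<le>\<^sub>0"
      using assms by (subst of_real_in_nonpos_Ints_iff) (auto elim!: nonpos_Ints_cases)
    thus "complex_of_real z + 1 / 2 \<notin> \<int>\<^sub>\<le>\<^sub>0" by simp
  qed
  also have "\<dots> = complex_of_real (exp ((1 - 2 * z) * ln 2) * sqrt pi * Gamma (2 * z))"
    by (simp flip: Gamma_complex_of_real exp_of_real)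
  finally have "Gamma z * Gamma (z + 1 / 2) = exp ((1 - 2 * z) * ln 2) * sqrt pi * Gamma (2 * z)"
    unfolding of_real_eq_iff .
  hence "ln (Gamma z * Gamma (z + 1 / 2)) = ln (exp ((1 - 2 * z) * ln 2) * sqrt pi * Gamma (2 * z))"
    by simp
  thus ?thesis
    using assms Gamma_real_pos[of z] Gamma_real_pos[of "z + 1 / 2"] Gamma_real_pos[of "2 * z"]
    by (simp add: ln_mult_pos ln_sqrt ln_Gamma_real_pos)
qed

text \<open>
  The limit along \<open>x + n\<close> is the same \<open>L\<close> for every \<open>x\<close>. The duplication formula at \<open>z = n\<close>
  relates the errors at \<open>n\<close>, \<open>n + 1/2\<close> and \<open>2 n\<close>; in the limit it says \<open>L + L - L = 0\<close>. The
  constant \<open>ln (2 * pi) / 2\<close> in the Stirling sum is the one for which the right-hand side is zero.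
\<close>
lemma stirling_error_0_tendsto_0:
  assumes "x > 0"
  shows "(\<lambda>n. stirling_error 0 (x + real n) 0) \<longlonglongrightarrow> 0"
proof -
  obtain L where L: "(\<lambda>n. stirling_error 0 (real n) 0) \<longlonglongrightarrow> L"
    using stirling_error_convergent by (auto simp: convergent_def)
  have lim: "(\<lambda>n. stirling_error 0 (y + real n) 0) \<longlonglongrightarrow> L" if "y > 0" for y
  proof -
    from tendsto_add[OF stirling_error_0_shift_asymp[OF that] LIMSEQ_Suc[OF L]]
    have "(\<lambda>n. stirling_error 0 (y + real (Suc n)) 0) \<longlonglongrightarrow> L" by simp
    thus ?thesis by (rule LIMSEQ_imp_Suc)
  qed
  have L2: "(\<lambda>n. stirling_error 0 (2 * real n) 0) \<longlonglongrightarrow> L"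
  proof -
    have "filterlim (\<lambda>n. 2 * n) sequentially sequentially"
      by (rule filterlim_subseq) (auto simp: strict_mono_def)
    from filterlim_compose[OF L this] show ?thesis by simp
  qed
  have ln_2pi: "ln (2 * pi) = ln 2 + ln pi"
    by (intro ln_mult_pos) auto
  have "(\<lambda>n. stirling_error 0 (real n) 0 + stirling_error 0 (1 / 2 + real n) 0
          - stirling_error 0 (2 * real n) 0) \<longlonglongrightarrow> L + L - L"
    by (intro tendsto_intros L L2 lim) auto
  moreover have "(\<lambda>n. stirling_error 0 (real n) 0 + stirling_error 0 (1 / 2 + real n) 0
          - stirling_error 0 (2 * real n) 0) \<longlonglongrightarrow> 0"
  proof (rule Lim_transform_eventually)
    show "(\<lambda>n. (1 - 2 * real n) * ln 2 + ln pi / 2 - ln (2 * pi) / 2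
            + ln (real n) / 2 + ln (real n + 1 / 2) / 2 - ln (2 * real n) / 2
            - real n * ln (real n) - (real n + 1 / 2) * ln (real n + 1 / 2)
            + 2 * real n * ln (2 * real n) + 1 / 2) \<longlonglongrightarrow> 0"
      unfolding ln_2pi add_divide_distrib by real_asymp
    show "eventually (\<lambda>n. (1 - 2 * real n) * ln 2 + ln pi / 2 - ln (2 * pi) / 2
            + ln (real n) / 2 + ln (real n + 1 / 2) / 2 - ln (2 * real n) / 2
            - real n * ln (real n) - (real n + 1 / 2) * ln (real n + 1 / 2)
            + 2 * real n * ln (2 * real n) + 1 / 2
          = stirling_error 0 (real n) 0 + stirling_error 0 (1 / 2 + real n) 0
          - stirling_error 0 (2 * real n) 0) sequentially"
      using eventually_gt_at_top[of 0]
    proof eventually_elim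
      case (elim n)
      thus ?case
        using ln_Gamma_duplication[of "real n"]
        by (simp add: stirling_error_0_eq add.commute[of "1/2"])
    qed
  qed
  ultimately have "L = 0"
    using LIMSEQ_unique by fastforce
  with lim[OF assms] show ?thesis by simp
qed

section \<open>Uniform Stirling expansion\<close>

text \<open>
  The steps are summed from \<open>x\<close> to infinity, where
  \<open>1 / y\<^sup>2 \<le> 1 / (y - 1) - 1 / y\<close> makes the sum telescope.
\<close>
lemma telescoping_decay:
  fixes f :: "real \<Rightarrow> real"
  assumes "C \<ge> 0" and "x \<ge> 2"
  assumes step: "\<And>y. y \<ge> 2 \<Longrightarrow> \<bar>f (y + 1) - f y\<bar> \<le> C / y ^ (m + 2)"
  assumes lim: "(\<lambda>n. f (x + real n)) \<longlonglongrightarrow> 0"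
  shows "\<bar>f x\<bar> \<le> 2 * C / x ^ (m + 1)"
proof -
  have bound: "\<bar>f (x + real n) - f x\<bar> \<le> C / x ^ m * (1 / (x - 1) - 1 / (x + real n - 1))" for n
  proof (induction n)
    case (Suc n)
    define y where "y = x + real n"
    have y: "y \<ge> 2" "y \<ge> x" using assms by (auto simp: y_def)
    have "\<bar>f (y + 1) - f y\<bar> \<le> C / y ^ (m + 2)" by (rule step) fact
    also have "\<dots> \<le> C / (x ^ m * (y * (y - 1)))"
      unfolding power_add power2_eq_square using y assms
      by (intro divide_left_mono mult_mono power_mono) auto
    also have "\<dots> = C / x ^ m * (1 / (y - 1) - 1 / y)"
      using y by (simp add: field_simps)
    finally have "\<bar>f (y + 1) - f y\<bar> \<le> C / x ^ m * (1 / (y - 1) - 1 / y)" .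
    with Suc.IH show ?case
      by (simp add: y_def algebra_simps)
  qed auto
  have "\<bar>f (x + real n) - f x\<bar> \<le> 2 * C / x ^ (m + 1)" for n
  proof -
    have "1 / (x - 1) - 1 / (x + real n - 1) \<le> 2 / x"
    proof -
      have "1 / (x - 1) \<le> 2 / x" using assms by (simp add: field_simps)
      moreover have "1 / (x + real n - 1) \<ge> 0" using assms by simp
      ultimately show ?thesis by linarith
    qed
    hence "C / x ^ m * (1 / (x - 1) - 1 / (x + real n - 1)) \<le> C / x ^ m * (2 / x)"
      using assms by (intro mult_left_mono) auto
    with bound[of n] show ?thesis by (simp add: mult_ac)
  qed
  moreover have "(\<lambda>n. \<bar>f (x + real n) - f x\<bar>) \<longlonglongrightarrow> \<bar>0 - f x\<bar>"
    by (intro tendsto_intros lim)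
  ultimately have "\<bar>0 - f x\<bar> \<le> 2 * C / x ^ (m + 1)"
    by (intro LIMSEQ_le_const2) auto
  thus ?thesis by simp
qed

text \<open>
  Summing the steps loses one power of \<open>x\<close>. So they are summed for \<open>M + 1\<close>, and the additional
  term of the series is absorbed into the bound.
\<close>
lemma stirling_error_bound_origin:
  obtains C where "C \<ge> 0" "\<And>x. x \<ge> 2 \<Longrightarrow> \<bar>stirling_error M x 0\<bar> \<le> C / x ^ (M + 1)"
proof -
  obtain C where C: "C \<ge> 0"
    "\<And>x. x \<ge> 2 \<Longrightarrow> \<bar>stirling_error (Suc M) (x + 1) 0 - stirling_error (Suc M) x 0\<bar> \<le> C / x ^ (Suc M + 1)"
    by (rule stirling_error_step[of "Suc M"]) auto
  define D where "D = \<bar>recip_bernpoly (M + 2) 0 / (real (M + 1) * real (M + 2))\<bar>"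
  have "\<bar>stirling_error M x 0\<bar> \<le> (2 * C + D) / x ^ (M + 1)" if x: "x \<ge> 2" for x
  proof -
    have "filterlim (\<lambda>n. x + real n) at_top sequentially"
      by (intro filterlim_tendsto_add_at_top[OF tendsto_const] filterlim_real_sequentially)
    from tendsto_add[OF stirling_error_tendsto_base[OF this, of "Suc M"] stirling_error_0_tendsto_0[of x]]
    have "(\<lambda>n. stirling_error (Suc M) (x + real n) 0) \<longlonglongrightarrow> 0"
      using x by simp
    hence "\<bar>stirling_error (Suc M) x 0\<bar> \<le> 2 * C / x ^ (M + 1)"
      using C x by (intro telescoping_decay) auto
    moreover have "\<bar>stirling_error M x 0 - stirling_error (Suc M) x 0\<bar> = D / x ^ (M + 1)"
      using x by (simp add: stirling_error_def stirling_sum_Suc D_def abs_mult power_abs)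
    ultimately show ?thesis unfolding add_divide_distrib by linarith
  qed
  moreover have "2 * C + D \<ge> 0" using C by (simp add: D_def)
  ultimately show ?thesis by (intro that)
qed

theorem stirling_expansion:
  assumes "T \<ge> 0"
  obtains C where "C \<ge> 0"
    "\<And>x t. x \<ge> 2 * T + 4 \<Longrightarrow> \<bar>t\<bar> \<le> T \<Longrightarrow> \<bar>stirling_error M x t\<bar> \<le> C / x ^ (M + 1)"
proof -
  obtain C where C: "\<And>x t. x > 0 \<Longrightarrow> x \<ge> 2 * T \<Longrightarrow> \<bar>t\<bar> \<le> T \<Longrightarrow>
       \<bar>stirling_error M x t - stirling_error M (x + t) 0\<bar> \<le> C / x ^ (M + 1)"
    using stirling_error_transport[OF assms, of M] by metis
  obtain D where D: "D \<ge> 0" "\<And>x. x \<ge> 2 \<Longrightarrow> \<bar>stirling_error M x 0\<bar> \<le> D / x ^ (M + 1)"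
    using stirling_error_bound_origin[of M] by blast
  have *: "\<bar>stirling_error M x t\<bar> \<le> (\<bar>C\<bar> + D * 2 ^ (M + 1)) / x ^ (M + 1)"
    if x: "x \<ge> 2 * T + 4" and t: "\<bar>t\<bar> \<le> T" for x t
  proof -
    \<comment> \<open>The threshold \<open>2 * T + 4\<close> puts \<open>x + t\<close> above \<open>2\<close>, where the bound at offset \<open>0\<close> applies.\<close>
    have xt: "x / 2 \<le> x + t" "x > 0" "x \<ge> 2 * T" "x + t \<ge> 2" using x t assms by linarith+
    have "\<bar>stirling_error M (x + t) 0\<bar> \<le> D / (x + t) ^ (M + 1)"
      by (rule D) fact
    also have "\<dots> \<le> D / (x / 2) ^ (M + 1)"
      using xt D by (intro divide_left_mono power_mono mult_pos_pos zero_less_power) auto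
    also have "\<dots> = D * 2 ^ (M + 1) / x ^ (M + 1)"
      by (simp add: power_divide)
    finally have "\<bar>stirling_error M (x + t) 0\<bar> \<le> D * 2 ^ (M + 1) / x ^ (M + 1)" .
    moreover have "\<bar>stirling_error M x t - stirling_error M (x + t) 0\<bar> \<le> \<bar>C\<bar> / x ^ (M + 1)"
      using xt by (intro order.trans[OF C[OF xt(2,3) t]] divide_right_mono) auto
    ultimately show ?thesis unfolding add_divide_distrib by linarith
  qed
  show ?thesis by (rule that[OF _ *]) (use D in auto)
qed

section \<open>Application to the negative binomial law\<close>

text \<open>
  With \<open>k = nb_mean r p + t\<close> one has \<open>k + r = r / p + t\<close>, so \<open>k + r\<close>, \<open>r\<close> and \<open>k\<close> lie at offsets
  \<open>t\<close>, \<open>0\<close> and \<open>t\<close> from \<open>r / p\<close>, \<open>r\<close> and \<open>r * (1 - p) / p\<close>. All three base points are multiples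
  of \<open>r\<close>, whence the powers of \<open>p\<close>, \<open>1\<close> and \<open>p / (1 - p)\<close> in \<^const>\<open>A_hat\<close>; the logarithmic and
  linear parts cancel.
\<close>
lemma stirling_sum_A_hat:
  assumes "0 < p" "p < 1" "r > 0"
  shows "stirling_sum M (r / p) t - stirling_sum M r 0 - stirling_sum M (nb_mean r p) t
           + ln (2 * pi) / 2 + r * ln p + (nb_mean r p + t) * ln (1 - p)
         = (\<Sum>n=1..M. A_hat n t p / r ^ n)"
proof -
  define y where "y = nb_mean r p"
  have y: "y = r * (1 - p) / p" by (simp add: y_def nb_mean_def)
  let ?S = "\<lambda>x t. \<Sum>n=1..M. (-1) ^ (n + 1) * recip_bernpoly (n + 1) t / (real n * (real n + 1) * x ^ n)"
  have series: "?S (r / p) t - ?S r 0 - ?S y t = (\<Sum>n=1..M. A_hat n t p / r ^ n)"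
    unfolding sum_subtractf [symmetric]
  proof (intro sum.cong refl)
    fix n assume n: "n \<in> {1..M}"
    have inv: "1 / (r / p) ^ n = p ^ n / r ^ n" "1 / y ^ n = (p / (1 - p)) ^ n / r ^ n"
      using assms by (simp_all add: y power_divide power_mult_distrib)
    have B: "recip_bernpoly (n + 1) 0 = bernoulli (n + 1)"
      using n by (intro recip_bernpoly_0) auto
    define c where "c = (-1) ^ (n + 1) / (real n * (real n + 1))"
    have c: "(-1) ^ (n + 1) * b / (real n * (real n + 1) * d) = c * b * (1 / d)" for b d
      by (simp add: c_def)
    show "(-1) ^ (n + 1) * recip_bernpoly (n + 1) t / (real n * (real n + 1) * (r / p) ^ n)
        - (-1) ^ (n + 1) * recip_bernpoly (n + 1) 0 / (real n * (real n + 1) * r ^ n)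
        - (-1) ^ (n + 1) * recip_bernpoly (n + 1) t / (real n * (real n + 1) * y ^ n)
        = A_hat n t p / r ^ n"
      unfolding c inv B A_hat_def c_def [symmetric] using assms by (simp add: field_simps)
  qed
  have ln: "ln (r / p) = ln r - ln p" "ln y = ln r + ln (1 - p) - ln p"
    using assms by (simp_all add: y ln_div ln_mult)
  have "r / p = y + r" using assms by (simp add: y field_simps)
  hence "(r / p + t) * ln (r / p) - r / p - (r * ln r - r) - ((y + t) * ln y - y)
          + r * ln p + (y + t) * ln (1 - p) = 0"
    unfolding ln by (simp add: algebra_simps)
  with series show ?thesis
    unfolding stirling_sum_def y_def [symmetric] by (simp add: algebra_simps)
qed

text \<open>
  The factor under the square root is what completes each \<open>ln_Gamma y\<close> to
  \<open>ln_Gamma y + ln y / 2\<close>; half of the \<open>ln k\<close> from \<open>Gamma (k + 1) = k * Gamma k\<close> is used up by it.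
\<close>
lemma ln_nb_mass:
  assumes "0 < p" "p < 1" "r > 0" "k > 0"
  shows "ln (sqrt (2 * pi * (real k * (real k + r) / r)) * nb_mass r p k)
      = (ln_Gamma (real k + r) + ln (real k + r) / 2) - (ln_Gamma r + ln r / 2)
        - (ln_Gamma (real k) + ln (real k) / 2)
        + ln (2 * pi) / 2 + r * ln p + real k * ln (1 - p)"
proof -
  have k: "real k > 0" using assms by simp
  have "ln (sqrt (2 * pi * (real k * (real k + r) / r)))
      = (ln (2 * pi) + ln (real k) + ln (real k + r) - ln r) / 2"
    using assms k by (simp add: ln_sqrt ln_mult_pos ln_div)
  moreover have "ln (nb_mass r p k) = ln_Gamma (real k + r) - ln_Gamma r - ln_Gamma (real k + 1)
      + r * ln p + real k * ln (1 - p)"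
  proof -
    have "Gamma (real k + r) \<noteq> 0" "Gamma r \<noteq> 0" "Gamma (real k + 1) \<noteq> 0"
      using assms k by (auto simp: Gamma_eq_zero_iff elim!: nonpos_Ints_cases)
    thus ?thesis
      unfolding nb_mass_def using assms
      by (simp add: ln_mult_pos ln_div ln_powr ln_realpow ln_Gamma_real_pos)
  qed
  moreover have "nb_mass r p k > 0"
    unfolding nb_mass_def using assms by (intro mult_pos_pos divide_pos_pos) auto
  moreover have "sqrt (2 * pi * (real k * (real k + r) / r)) > 0"
    using assms k by (simp add: add_pos_pos)
  ultimately show ?thesis
    using ln_Gamma_real_plus1[OF k] by (simp add: ln_mult_pos field_simps)
qed

lemma ln_nb_mass_stirling_error:
  assumes "0 < p" "p < 1" "r > 0" "k > 0" "real k = nb_mean r p + t"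
  shows "ln (sqrt (2 * pi * (real k * (real k + r) / r)) * nb_mass r p k)
           - (\<Sum>n=1..M. A_hat n t p / r ^ n)
       = stirling_error M (r / p) t - stirling_error M r 0 - stirling_error M (nb_mean r p) t"
proof -
  have "real k + r = r / p + t"
    using assms by (simp add: nb_mean_def field_simps)
  thus ?thesis
    unfolding ln_nb_mass[OF assms(1-4)] stirling_sum_A_hat[OF assms(1-3), symmetric]
              stirling_error_def
    by (simp add: assms(5) [symmetric])
qed

theorem theorem4p2:
  fixes I H :: "real set"
  assumes "compact I" and "I \<subseteq> {0<..<1}" and "compact H"
  shows "\<forall>M::nat. \<exists>C R :: real. R > 0 \<and>
    (\<forall>r\<ge>R. \<forall>p\<in>I. \<forall>t\<in>H. \<forall>k::nat. real k = nb_mean r p + t \<longrightarrow>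
       k > 0 \<and>
       \<bar>ln (sqrt (2 * pi * (real k * (real k + r) / r)) * nb_mass r p k)
          - (\<Sum>n=1..M. A_hat n t p / r ^ n)\<bar> \<le> C / r ^ (M + 1))"
proof
  fix M :: nat
  obtain b where b: "0 \<le> b" "b < 1" "\<And>p. p \<in> I \<Longrightarrow> p \<le> b"
  proof (cases "I = {}")
    case False
    with assms(1) obtain b where "b \<in> I" "\<forall>p\<in>I. p \<le> b"
      using compact_attains_sup[of I] by blast
    thus ?thesis using assms(2) by (intro that[of b]) force+
  qed (use that[of 0] in auto)
  have "bounded H"
    using assms(3) by (rule compact_imp_bounded)
  then obtain T where T: "T > 0" "\<And>t. t \<in> H \<Longrightarrow> \<bar>t\<bar> \<le> T"
    by (auto simp: bounded_pos)
  obtain C where C: "C \<ge> 0"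
    "\<And>x t. x \<ge> 2 * T + 4 \<Longrightarrow> \<bar>t\<bar> \<le> T \<Longrightarrow> \<bar>stirling_error M x t\<bar> \<le> C / x ^ (M + 1)"
    using stirling_expansion[of T M] T(1) by auto
  \<comment> \<open>A common lower bound \<open>r * c\<close> for the three base points: \<open>r * (1 - p) / p\<close> is at least
    \<open>r * (1 - b)\<close>, and the other two are at least \<open>r\<close>.\<close>
  define c where "c = 1 - b"
  have c: "0 < c" "c \<le> 1" using b(1,2) by (auto simp: c_def)
  define R where "R = (2 * T + 4) / c"
  show "\<exists>C R :: real. R > 0 \<and>
    (\<forall>r\<ge>R. \<forall>p\<in>I. \<forall>t\<in>H. \<forall>k::nat. real k = nb_mean r p + t \<longrightarrow>
       k > 0 \<and>
       \<bar>ln (sqrt (2 * pi * (real k * (real k + r) / r)) * nb_mass r p k)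
          - (\<Sum>n=1..M. A_hat n t p / r ^ n)\<bar> \<le> C / r ^ (M + 1))"
  proof (rule exI[of _ "3 * C / c ^ (M + 1)"], rule exI[of _ R], intro conjI ballI allI impI)
    show "R > 0" using T c by (simp add: R_def)
  next
    fix r p t :: real and k :: nat
    assume r: "r \<ge> R" and p: "p \<in> I" and t: "t \<in> H" and k: "real k = nb_mean r p + t"
    have p': "0 < p" "p < 1" "p \<le> b" using p assms(2) b(3) by auto
    have rc: "r * c \<ge> 2 * T + 4" using r c by (simp add: R_def field_simps)
    hence r0: "r > 0" using c T(1) by (smt (verit) mult_nonneg_nonpos2 mult_nonpos_nonneg)
    have 1: "r * c \<le> r" using c r0 by (simp add: mult_left_le)
    have 2: "r \<le> r / p" using p' r0 by (simp add: field_simps)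
    have 3: "r * c \<le> nb_mean r p"
    proof -
      have "r * c \<le> r * (1 - p)" using r0 p' by (intro mult_left_mono) (auto simp: c_def)
      also have "\<dots> \<le> r * (1 - p) / p" using p' r0 by (simp add: pos_le_divide_eq mult_left_le)
      finally show ?thesis by (simp add: nb_mean_def)
    qed
    have tT: "\<bar>t\<bar> \<le> T" using T t by auto
    show k0: "k > 0"
    proof -
      have "real k > 0" using k 3 rc tT T(1) by linarith
      thus ?thesis by simp
    qed
    have err: "\<bar>stirling_error M x s\<bar> \<le> C / (r * c) ^ (M + 1)" if "r * c \<le> x" "\<bar>s\<bar> \<le> T" for x s
    proof -
      have x: "x > 0" using that rc T(1) by linarith
      have "\<bar>stirling_error M x s\<bar> \<le> C / x ^ (M + 1)" using that rc by (intro C(2)) auto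
      also have "\<dots> \<le> C / (r * c) ^ (M + 1)"
        using that c r0 C(1) x by (intro divide_left_mono power_mono mult_pos_pos zero_less_power) auto
      finally show ?thesis .
    qed
    have "\<bar>stirling_error M (r / p) t - stirling_error M r 0 - stirling_error M (nb_mean r p) t\<bar>
        \<le> 3 * (C / (r * c) ^ (M + 1))"
      using err[of "r / p" t] err[of r 0] err[of "nb_mean r p" t] 1 2 3 tT T(1) by linarith
    also have "\<dots> = 3 * C / c ^ (M + 1) / r ^ (M + 1)"
      by (simp add: power_mult_distrib mult_ac)
    finally show "\<bar>ln (sqrt (2 * pi * (real k * (real k + r) / r)) * nb_mass r p k)
          - (\<Sum>n=1..M. A_hat n t p / r ^ n)\<bar> \<le> 3 * C / c ^ (M + 1) / r ^ (M + 1)"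
      unfolding ln_nb_mass_stirling_error[OF p'(1,2) r0 k0 k] .
  qed
qed

end
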